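(* Let $a\in\mathbb R$, $a<b\le\infty$, $m\in\mathbb N$, and let $F:\mathcal D^{lc}([a,b))^m\to\mathcal D^{lc}([a,b))^m$. Assume that $$\lceil F(y)-F(z)\rceil\le G(\lceil y-z\rceil)\quad\text{whenever }y,z\in\mathcal D^{lc}([a,b))^m,$$ where $G:\mathcal H_+([a,b))\to\mathcal H_+([a,b))$ has the following properties: $G$ is increasing, i.e. $G(u)\le G(v)$ whenever $u\le v$; and for each $u\in\mathcal H_+([a,b))$ there exists $w_0\in\mathcal H_+([a,b))$ with $u\le w_0$ such that $\inf G[W]=\theta$, where $W$ is the inversely well-ordered chain in $\mathcal H_+([a,b))$ satisfying: $\max W=w_0$, and if $v<w_0$, then $v\in W$ if and only if $v=\inf G[\{w\in W:v<w\}]$. Then $F$ has at most one fixed point, i.e. there is at most one $y\in\mathcal D^{lc}([a,b))^m$ with $y=F(y)$.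
   Context: $\mathcal D^{lc}([a,b))$ is the space of functions $[a,b)\to\mathbb R$ that are Henstock--Kurzweil integrable on every compact subinterval of $[a,b)$, right continuous at $a$ and left continuous on $(a,b)$. For $x=(x_1,\dots,x_m)\in\mathcal D^{lc}([a,b))^m$, $\lceil x\rceil$ denotes the function $t\mapsto\max\{|x_i(t)|:i=1,\dots,m\}$ on $[a,b)$. $\mathcal H_+([a,b))=\{\lceil x\rceil: x\in\mathcal D^{lc}([a,b))^m\}$, ordered pointwise, and $\theta$ is the zero function. All infima are taken in the partially ordered set $\mathcal H_+([a,b))$ (and a condition "$v=\inf A$" includes the existence of the infimum). A chain is inversely well-ordered if each of its nonempty subsets has a greatest element. (For each $w_0$ there is exactly one inversely well-ordered chain $W$ with the stated property.) *)

theory Defs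
  imports "HOL-Analysis.Analysis" "HOL-Library.Lub_Glb"
begin

text \<open>The upper end \<open>b\<close> may be \<open>\<infinity>\<close>, so it is an extended real.\<close>

definition half_open :: "real \<Rightarrow> ereal \<Rightarrow> real set" where
  "half_open a b = {t. a \<le> t \<and> ereal t < b}"

text \<open>
  A function on \<open>[a,b)\<close> is encoded as a total function \<open>real \<Rightarrow> real\<close> that vanishes outside
  \<open>[a,b)\<close>. Hence equality, the pointwise order and subtraction of the function type
  \<open>real \<Rightarrow> real\<close> are exactly those of functions on \<open>[a,b)\<close>. The library predicate
  \<open>integrable_on\<close> is Henstock-Kurzweil (gauge) integrability.
\<close>

definition Dlc :: "real \<Rightarrow> ereal \<Rightarrow> (real \<Rightarrow> real) set" where
  "Dlc a b = {f.
     (\<forall>t. t \<notin> half_open a b \<longrightarrow> f t = 0) \<and>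
     (\<forall>c d. {c..d} \<subseteq> half_open a b \<longrightarrow> f integrable_on {c..d}) \<and>
     continuous (at_right a) f \<and>
     (\<forall>t. a < t \<and> ereal t < b \<longrightarrow> continuous (at_left t) f)}"

definition Dlc_vec :: "real \<Rightarrow> ereal \<Rightarrow> ((real \<Rightarrow> real) ^ 'm::finite) set" where
  "Dlc_vec a b = {x. \<forall>i. x $ i \<in> Dlc a b}"

definition max_abs :: "(real \<Rightarrow> real) ^ 'm::finite \<Rightarrow> real \<Rightarrow> real" where
  "max_abs x = (\<lambda>t. MAX i. \<bar>(x $ i) t\<bar>)"

text \<open>The type argument carries the number \<open>m\<close> of components.\<close>

definition Hplus :: "'m::finite itself \<Rightarrow> real \<Rightarrow> ereal \<Rightarrow> (real \<Rightarrow> real) set" where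
  "Hplus _ a b = max_abs ` (Dlc_vec a b :: ((real \<Rightarrow> real) ^ 'm) set)"

definition inv_well_ordered_chain :: "'a::order set \<Rightarrow> bool" where
  "inv_well_ordered_chain W \<longleftrightarrow>
     Complete_Partial_Order.chain (\<le>) W \<and>
     (\<forall>B. B \<subseteq> W \<and> B \<noteq> {} \<longrightarrow> (\<exists>g. greatestP (\<lambda>w. w \<in> B) g))"

text \<open>
  \<open>isGlb H A v\<close> says that the infimum of \<open>A\<close> in the partially ordered set \<open>H\<close> exists and
  equals \<open>v\<close>; here \<open>G\<close> is a self-map of \<open>H\<close>.
\<close>

definition inv_iteration_chain :: "'a::order set \<Rightarrow> ('a \<Rightarrow> 'a) \<Rightarrow> 'a \<Rightarrow> 'a set \<Rightarrow> bool" where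
  "inv_iteration_chain H G w0 W \<longleftrightarrow>
     W \<subseteq> H \<and> inv_well_ordered_chain W \<and>
     greatestP (\<lambda>w. w \<in> W) w0 \<and>
     (\<forall>v\<in>H. v < w0 \<longrightarrow> (v \<in> W \<longleftrightarrow> isGlb H (G ` {w \<in> W. v < w}) v))"

end

theory Submission
  imports Defs
begin

text \<open>
  For two fixed points \<open>y\<close> and \<open>z\<close>, the distance \<open>u = \<lceil>y - z\<rceil>\<close> is a subsolution of \<open>G\<close>: the
  estimate for \<open>F\<close> gives \<open>u \<le> G u\<close>. The chain \<open>W\<close> is the transfinite sequence of
  iterates of \<open>G\<close> descending from a start \<open>w0 \<ge> u\<close>. Monotonicity of \<open>G\<close> preserves the bound
  \<open>u \<le> w\<close> from the elements above a given one to that element itself, so the bound holds on all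
  of \<open>W\<close> by induction along the inverse well-order
  (\<open>subsolution_le_inv_iteration_chain\<close>). Then \<open>u \<le> G u \<le> G w\<close> for every \<open>w \<in> W\<close>, which makes
  \<open>u\<close> a lower bound of \<open>G[W]\<close>. As the infimum of \<open>G[W]\<close> is zero, \<open>u = 0\<close> and hence \<open>y = z\<close>.

  Infima are taken in \<open>\<H>\<^sub>+\<close>, so \<open>u\<close> competes with them only as an element of \<open>\<H>\<^sub>+\<close>; this is where
  closure of \<open>\<D>\<^sup>l\<^sup>c\<close> under differences enters.
\<close>

lemma Dlc_diff:
  assumes "f \<in> Dlc a b" "g \<in> Dlc a b"
  shows "f - g \<in> Dlc a b"
  using assms unfolding Dlc_def fun_diff_def
  by (simp add: integrable_diff continuous_diff)

lemma Dlc_vec_diff: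
  assumes "x \<in> Dlc_vec a b" "y \<in> Dlc_vec a b"
  shows "x - y \<in> Dlc_vec a b"
  using assms by (simp add: Dlc_vec_def Dlc_diff)

lemma abs_component_le_max_abs: "\<bar>(x $ i) t\<bar> \<le> max_abs x t"
  by (simp add: max_abs_def)

lemma eq_if_max_abs_diff_le_zero:
  assumes "max_abs (x - y) \<le> (\<lambda>_. 0)"
  shows "x = y"
proof -
  have "\<bar>((x - y) $ i) t\<bar> \<le> 0" for i t
    using abs_component_le_max_abs[of "x - y" i t] assms
    by (meson le_funD order_trans)
  then show ?thesis
    by (simp add: vec_eq_iff fun_eq_iff)
qed

text \<open>
  A greatest element of the chain that is not above \<open>u\<close> cannot exist: it differs from \<open>w0\<close>,
  so it is the infimum of the values of \<open>G\<close> at strictly larger elements \<open>w\<close> of the chain,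
  and \<open>u \<le> G u \<le> G w\<close> for each of these puts \<open>u\<close> below the infimum.
\<close>

lemma subsolution_le_inv_iteration_chain:
  fixes H :: "'a::order set"
  assumes chain: "inv_iteration_chain H G w0 W"
    and mono: "mono_on H G"
    and u: "u \<in> H" "u \<le> G u" "u \<le> w0"
    and "w \<in> W"
  shows "u \<le> w"
proof (rule ccontr)
  assume "\<not> u \<le> w"
  with \<open>w \<in> W\<close> have "{w \<in> W. \<not> u \<le> w} \<subseteq> W \<and> {w \<in> W. \<not> u \<le> w} \<noteq> {}"
    by auto
  moreover have "\<forall>B. B \<subseteq> W \<and> B \<noteq> {} \<longrightarrow> (\<exists>g. greatestP (\<lambda>w. w \<in> B) g)"
    using chain by (simp add: inv_iteration_chain_def inv_well_ordered_chain_def)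
  ultimately obtain g where "greatestP (\<lambda>w. w \<in> {w \<in> W. \<not> u \<le> w}) g"
    by presburger
  then have g: "g \<in> W" "\<not> u \<le> g" and above: "\<And>w. w \<in> W \<Longrightarrow> \<not> u \<le> w \<Longrightarrow> w \<le> g"
    by (auto simp: greatestP_def setle_def)
  from chain have WH: "W \<subseteq> H" and "greatestP (\<lambda>w. w \<in> W) w0"
    by (simp_all add: inv_iteration_chain_def)
  with g u have "g \<in> H" "g < w0"
    by (auto simp: greatestP_def setle_def order_less_le)
  with chain g have inf: "isGlb H (G ` {w \<in> W. g < w}) g"
    by (auto simp: inv_iteration_chain_def)
  have "u \<le> G w" if "w \<in> W" "g < w" for w
  proof -
    from that above have "u \<le> w"
      by (meson leD)
    with that WH mono u show ?thesis
      by (meson mono_onD order_trans subsetD)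
  qed
  with inf u have "u \<le> g"
    by (auto simp: isGlb_def isLb_def greatestP_def setle_def setge_def)
  with g show False by simp
qed

theorem lemma7p2:
  fixes a :: real and b :: ereal
    and F :: "(real \<Rightarrow> real) ^ 'm::finite \<Rightarrow> (real \<Rightarrow> real) ^ 'm"
    and G :: "(real \<Rightarrow> real) \<Rightarrow> (real \<Rightarrow> real)"
  assumes "ereal a < b"
    and "F \<in> Dlc_vec a b \<rightarrow> Dlc_vec a b"
    and "G \<in> Hplus TYPE('m) a b \<rightarrow> Hplus TYPE('m) a b"
    and "\<And>y z. y \<in> Dlc_vec a b \<Longrightarrow> z \<in> Dlc_vec a b \<Longrightarrow>
           max_abs (F y - F z) \<le> G (max_abs (y - z))"
    and "mono_on (Hplus TYPE('m) a b) G"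
    and "\<And>u. u \<in> Hplus TYPE('m) a b \<Longrightarrow>
           \<exists>w0 \<in> Hplus TYPE('m) a b. u \<le> w0 \<and>
             (\<exists>W. inv_iteration_chain (Hplus TYPE('m) a b) G w0 W \<and>
                  isGlb (Hplus TYPE('m) a b) (G ` W) (\<lambda>_. 0))"
  shows "\<exists>\<^sub>\<le>\<^sub>1 y. y \<in> Dlc_vec a b \<and> y = F y"
proof (rule Uniq_I)
  fix y z
  assume y: "y \<in> Dlc_vec a b \<and> y = F y" and z: "z \<in> Dlc_vec a b \<and> z = F z"
  let ?H = "Hplus TYPE('m) a b"
  define u where "u = max_abs (y - z)"
  have uH: "u \<in> ?H"
    using y z by (simp add: u_def Hplus_def Dlc_vec_diff)
  have sub: "u \<le> G u"
    using assms(4)[of y z] y z by (simp add: u_def)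
  obtain w0 W where w0: "u \<le> w0" and chain: "inv_iteration_chain ?H G w0 W"
    and inf: "isGlb ?H (G ` W) (\<lambda>_. 0)"
    using assms(6)[OF uH] by blast
  have "u \<le> G w" if "w \<in> W" for w
  proof -
    have "u \<le> w"
      using subsolution_le_inv_iteration_chain[OF chain assms(5) uH sub w0 that] .
    moreover have "w \<in> ?H"
      using chain that by (auto simp: inv_iteration_chain_def)
    ultimately show ?thesis
      using sub mono_onD[OF assms(5) uH] by (meson order_trans)
  qed
  with inf uH have "u \<le> (\<lambda>_. 0)"
    by (auto simp: isGlb_def isLb_def greatestP_def setle_def setge_def)
  then show "y = z"
    by (simp add: u_def eq_if_max_abs_diff_le_zero)
qed

end
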